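(* If there is a Sierpiński subset of the real line, then there is a regular topological space $X$ that is a Menger space and does not satisfy $\mathsf S_1(\mathcal K_X,\mathcal O_X)$.
   Context: A Sierpiński subset of the real line is an uncountable set $S\subseteq\mathbb R$ such that $S\cap A$ is countable for every Lebesgue measure zero subset $A$ of $\mathbb R$. A topological space $X$ is a Menger space if, for every sequence $(\mathcal U_n)_{n\in\omega}$ of open covers of $X$, there is a sequence $(\mathcal F_n)_{n\in\omega}$ such that each $\mathcal F_n$ is a finite subset of $\mathcal U_n$ and $\bigcup_{n\in\omega}\mathcal F_n$ covers $X$. $\mathcal O_X$ is the family of all open covers of $X$. A $k$-cover of $X$ is an open cover $\mathcal U$ of $X$ such that every compact subset of $X$ is included in some element of $\mathcal U$; $\mathcal K_X$ is the family of all $k$-covers of $X$. $\mathsf S_1(\mathcal A,\mathcal B)$ is the statement: for every sequence $(A_n)_{n\in\omega}$ of elements of $\mathcal A$ there is a sequence $(B_n)_{n\in\omega}$ with $B_n\in A_n$ for each $n\in\omega$ and $\{B_n:n\in\omega\}\in\mathcal B$. *)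

theory Defs
  imports "HOL-Analysis.Analysis"
begin

definition Sierpinski_set :: "real set \<Rightarrow> bool" where
  "Sierpinski_set S \<longleftrightarrow>
     uncountable S \<and> (\<forall>A \<in> null_sets lebesgue. countable (S \<inter> A))"

definition open_covers :: "'a topology \<Rightarrow> 'a set set set" where
  "open_covers X = {\<U>. (\<forall>U\<in>\<U>. openin X U) \<and> \<Union>\<U> = topspace X}"

definition k_covers :: "'a topology \<Rightarrow> 'a set set set" where
  "k_covers X = {\<U> \<in> open_covers X. \<forall>K. compactin X K \<longrightarrow> (\<exists>U\<in>\<U>. K \<subseteq> U)}"

definition Menger_space :: "'a topology \<Rightarrow> bool" where
  "Menger_space X \<longleftrightarrow>
     (\<forall>\<U> :: nat \<Rightarrow> 'a set set. (\<forall>n. \<U> n \<in> open_covers X) \<longrightarrow>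
        (\<exists>\<F> :: nat \<Rightarrow> 'a set set.
            (\<forall>n. finite (\<F> n) \<and> \<F> n \<subseteq> \<U> n) \<and> \<Union>(\<Union>n. \<F> n) = topspace X))"

definition S1 :: "'b set set \<Rightarrow> 'b set set \<Rightarrow> bool" where
  "S1 \<A> \<B> \<longleftrightarrow>
     (\<forall>A :: nat \<Rightarrow> 'b set. (\<forall>n. A n \<in> \<A>) \<longrightarrow>
        (\<exists>B :: nat \<Rightarrow> 'b. (\<forall>n. B n \<in> A n) \<and> range B \<in> \<B>))"

end

theory Submission
  imports Defs
begin

text \<open>
  The space is a Sierpinski set \<open>S\<close> itself, with the topology inherited from the real line.

  It is Menger because measure alone reduces the covering problem to countably many points. From
  the \<open>n\<close>-th cover, finitely many members already cover the part of \<open>S\<close> in the ball of radius \<open>n\<close>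
  up to a set of measure less than \<open>1 / 2 ^ n\<close>
  (\<open>finite_subfamily_small_remainder\<close>). By the Borel--Cantelli lemma, the points missed by
  infinitely many of these selections form a null set, which meets \<open>S\<close> in a countable set; adding one
  further member from each cover catches those points one at a time
  (\<open>Menger_space_of_countable_negligible_traces\<close>).

  It fails the selection principle because its compact subsets are small whereas \<open>S\<close> is not. An
  uncountable closed set contains an uncountable null set
  (\<open>uncountable_closed_contains_uncountable_negligible\<close>), so every compact subset of \<open>S\<close> is
  countable. Hence the traces on \<open>S\<close> of the open sets of measure less than any fixed \<open>\<epsilon>\<close> form a
  \<open>k\<close>-cover. Choosing one such trace for each \<open>\<epsilon> / 2 ^ (n + 1)\<close> covers a set of outer measure at
  most \<open>\<epsilon>\<close>, and this is not all of \<open>S\<close> once \<open>\<epsilon>\<close> is below the outer measure of \<open>S\<close>, which is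
  positive since \<open>S\<close>, being uncountable, is not null.
\<close>

section \<open>Uncountable closed sets contain uncountable null sets\<close>

lemma countable_imp_negligible:
  fixes C :: "'a::euclidean_space set"
  assumes "countable C"
  shows "negligible C"
  using negligible_countable_Union[of "(\<lambda>x. {x}) ` C"] assms by auto

lemma negligible_outer_openE:
  fixes N :: "'a::euclidean_space set"
  assumes "negligible N" "e > 0"
  obtains T where "open T" "N \<subseteq> T" "T \<in> lmeasurable" "measure lebesgue T < e"
proof -
  have null: "N \<in> null_sets lebesgue"
    using assms(1) by (simp add: negligible_iff_null_sets)
  then obtain T where T: "open T" "N \<subseteq> T" "T - N \<in> lmeasurable"
      "emeasure lebesgue (T - N) < ennreal e"
    using sets_lebesgue_outer_open[of N e] assms(2) by blast
  have "T \<in> sets lebesgue"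
    using T(1) by auto
  then have eq: "emeasure lebesgue (T - N) = emeasure lebesgue T"
    using null by (rule emeasure_Diff_null_set[rotated])
  then have "T \<in> lmeasurable"
    using fmeasurableD2[OF T(3)] \<open>T \<in> sets lebesgue\<close> unfolding eq
    by (intro fmeasurableI) (simp_all add: less_top)
  moreover have "measure lebesgue T < e"
    using T(4) assms(2) unfolding eq
    by (metis emeasure_eq_measure2 ennreal_less_iff measure_nonneg calculation)
  ultimately show ?thesis
    using T that by blast
qed

text \<open>
  Cantor--Bendixson: by the Lindelof property the open sets with countable trace on \<open>K\<close> have a union
  with countable trace, so removing that union leaves only condensation points of what remains.
\<close>
lemma uncountable_closed_perfect_kernel:
  fixes K :: "'a::second_countable_topology set"
  assumes "closed K" "uncountable K"
  obtains P where "closed P" "P \<subseteq> K" "P \<noteq> {}"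
    "\<And>V. open V \<Longrightarrow> V \<inter> P \<noteq> {} \<Longrightarrow> uncountable (V \<inter> P)"
proof -
  define \<W> where "\<W> = {V. open V \<and> countable (V \<inter> K)}"
  obtain \<W>' where \<W>': "\<W>' \<subseteq> \<W>" "countable \<W>'" "\<Union>\<W>' = \<Union>\<W>"
    using Lindelof[of \<W>] by (auto simp: \<W>_def)
  have "countable (\<Union>V\<in>\<W>'. V \<inter> K)"
    using \<W>' by (intro countable_UN) (auto simp: \<W>_def)
  then have small: "countable (\<Union>\<W> \<inter> K)"
    using \<W>'(3) by (metis Int_Union2)
  show ?thesis
  proof
    have "open (\<Union>\<W>)"
      by (auto simp: \<W>_def)
    then show "closed (K - \<Union>\<W>)"
      using assms(1) by (rule closed_Diff[rotated])
    show "K - \<Union>\<W> \<noteq> {}"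
      using small assms(2) by (metis Diff_eq_empty_iff inf.absorb2)
    fix V :: "'a set"
    assume V: "open V" "V \<inter> (K - \<Union>\<W>) \<noteq> {}"
    then have "uncountable (V \<inter> K)"
      by (auto simp: \<W>_def)
    moreover have "V \<inter> K \<subseteq> V \<inter> (K - \<Union>\<W>) \<union> \<Union>\<W> \<inter> K"
      by auto
    ultimately show "uncountable (V \<inter> (K - \<Union>\<W>))"
      using small by (meson countable_Un countable_subset)
  qed auto
qed

text \<open>
  Inside the perfect kernel, intersecting ever smaller open neighbourhoods of a countable dense set
  gives a null set that is also a dense \<open>G\<^sub>\<delta>\<close>. It is uncountable by the Baire category theorem,
  since in a set without isolated points deleting a single point leaves a dense open set.
\<close>
lemma uncountable_closed_contains_uncountable_negligible:
  fixes K :: "'a::euclidean_space set"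
  assumes "closed K" "uncountable K"
  obtains N where "N \<subseteq> K" "negligible N" "uncountable N"
proof -
  obtain P where P: "closed P" "P \<subseteq> K" "P \<noteq> {}"
    and cond: "\<And>V. open V \<Longrightarrow> V \<inter> P \<noteq> {} \<Longrightarrow> uncountable (V \<inter> P)"
    using uncountable_closed_perfect_kernel[OF assms] by blast
  obtain D where D: "countable D" "D \<subseteq> P" "P \<subseteq> closure D"
    using separable[of P] by blast
  have "negligible D"
    using D(1) by (rule countable_imp_negligible)
  then have "\<exists>T. open T \<and> D \<subseteq> T \<and> T \<in> lmeasurable \<and> measure lebesgue T < 1 / real (Suc n)" for n
    by (meson negligible_outer_openE of_nat_0_less_iff zero_less_Suc zero_less_divide_1_iff)
  then obtain T where T: "\<And>n. open (T n)" "\<And>n. D \<subseteq> T n" "\<And>n. T n \<in> lmeasurable"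
      "\<And>n. measure lebesgue (T n) < 1 / real (Suc n)"
    by metis
  define N where "N = P \<inter> (\<Inter>n. T n)"
  have "\<exists>U. N \<subseteq> U \<and> U \<in> lmeasurable \<and> measure lebesgue U < e" if e: "e > 0" for e
  proof -
    obtain n where "1 / real (Suc n) < e"
      using e by (rule nat_approx_posE)
    then have "measure lebesgue (T n) < e"
      using T(4)[of n] by linarith
    moreover have "N \<subseteq> T n"
      by (auto simp: N_def)
    ultimately show ?thesis
      using T(3) by blast
  qed
  then have "negligible N"
    by (simp add: negligible_outer)
  moreover have "uncountable N"
  proof
    assume "countable N"
    define \<G> where "\<G> = range (\<lambda>n. P \<inter> T n) \<union> (\<lambda>x. P - {x}) ` N"
    have "P \<subseteq> closure (\<Inter>\<G>)"
    proof (rule Baire)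
      show "countable \<G>"
        using \<open>countable N\<close> by (simp add: \<G>_def)
      fix G assume "G \<in> \<G>"
      then consider n where "G = P \<inter> T n" | x where "G = P - {x}"
        by (auto simp: \<G>_def)
      then show "openin (top_of_set P) G \<and> P \<subseteq> closure G"
      proof cases
        case 1
        then have "D \<subseteq> G"
          using D(2) T(2) by auto
        then have "P \<subseteq> closure G"
          using D(3) closure_mono by blast
        then show ?thesis
          using 1 T(1) by (simp add: openin_open_Int)
      next
        case 2
        have "V \<inter> (P - {x}) \<noteq> {}" if "open V" "V \<inter> P \<noteq> {}" for V
        proof
          assume "V \<inter> (P - {x}) = {}"
          then have "V \<inter> P \<subseteq> {x}"
            by auto
          then show False
            using cond[OF that] by (meson countable_empty countable_insert countable_subset)
        qed
        from this[of "- closure (P - {x})"] have "P \<subseteq> closure (P - {x})"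
          using closure_subset[of "P - {x}"] by auto
        moreover have "openin (top_of_set P) (P - {x})"
          by (metis Diff_eq open_Compl closed_singleton openin_open_Int)
        ultimately show ?thesis
          using 2 by simp
      qed
    qed (rule P(1))
    moreover have "\<Inter>\<G> = {}"
    proof (rule equals0I)
      fix x assume x: "x \<in> \<Inter>\<G>"
      then have "x \<in> N"
        by (auto simp: \<G>_def N_def)
      then show False
        using x by (auto simp: \<G>_def)
    qed
    ultimately show False
      using P(3) by simp
  qed
  ultimately show ?thesis
    using that P(2) by (metis N_def Int_lower1 order_trans)
qed

section \<open>The Menger property\<close>

text \<open>
  This is continuity of the measure from below along a countable subcover. Intersecting with a set
  \<open>B\<close> of finite measure is what makes the remainder small in measure.
\<close>
lemma finite_subfamily_small_remainder:
  fixes B :: "'a::euclidean_space set"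
  assumes B: "B \<in> lmeasurable" and opn: "\<And>V. V \<in> \<V> \<Longrightarrow> open V" and "e > 0"
  obtains \<F> where "finite \<F>" "\<F> \<subseteq> \<V>" "B \<inter> \<Union>\<V> - \<Union>\<F> \<in> lmeasurable"
    "measure lebesgue (B \<inter> \<Union>\<V> - \<Union>\<F>) < e"
proof -
  obtain \<V>' where \<V>': "\<V>' \<subseteq> \<V>" "countable \<V>'" "\<Union>\<V>' = \<Union>\<V>"
    using Lindelof opn by metis
  have meas: "B \<inter> V \<in> lmeasurable" if "open V" for V
    using B that by (simp add: fmeasurable_Int_fmeasurable)
  have measB: "(\<inter>) B ` \<V>' \<subseteq> lmeasurable"
  proof (rule image_subsetI)
    fix V assume "V \<in> \<V>'"
    then show "B \<inter> V \<in> lmeasurable"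
      using \<V>'(1) by (intro meas opn) auto
  qed
  obtain \<D> where \<D>: "\<D> \<subseteq> (\<inter>) B ` \<V>'" "finite \<D>"
    "measure lebesgue (\<Union>((\<inter>) B ` \<V>')) - e < measure lebesgue (\<Union>\<D>)"
  proof (rule measure_countable_Union_approachable)
    show "countable ((\<inter>) B ` \<V>')"
      using \<V>'(2) by simp
    show "d \<in> lmeasurable" if "d \<in> (\<inter>) B ` \<V>'" for d
      using that measB by (rule subsetD[rotated])
    show "measure lebesgue (\<Union>\<D>') \<le> measure lebesgue B"
      if "\<D>' \<subseteq> (\<inter>) B ` \<V>'" "finite \<D>'" for \<D>'
    proof (rule measure_mono_fmeasurable)
      show "\<Union>\<D>' \<in> sets lebesgue"
      proof (rule sets.finite_Union[OF that(2)])
        show "\<D>' \<subseteq> sets lebesgue"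
          using that(1) measB by (meson fmeasurableD subset_iff)
      qed
    qed (use that B in auto)
  qed (rule assms(3))
  obtain \<F> where \<F>: "finite \<F>" "\<F> \<subseteq> \<V>'" "\<D> = (\<inter>) B ` \<F>"
    using \<D>(1,2) by (metis finite_subset_image)
  have eqV: "\<Union>((\<inter>) B ` \<V>') = B \<inter> \<Union>\<V>" and eqF: "\<Union>\<D> = B \<inter> \<Union>\<F>"
    using \<V>'(3) \<F>(3) by auto
  have "open (\<Union>\<V>)" "open (\<Union>\<F>)"
    using opn \<F>(2) \<V>'(1) by blast+
  then have m: "B \<inter> \<Union>\<V> \<in> lmeasurable" "B \<inter> \<Union>\<F> \<in> lmeasurable"
    using meas by blast+
  have diff: "B \<inter> \<Union>\<V> - \<Union>\<F> = B \<inter> \<Union>\<V> - B \<inter> \<Union>\<F>"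
    by auto
  have "B \<inter> \<Union>\<F> \<subseteq> B \<inter> \<Union>\<V>"
    using \<F>(2) \<V>'(1) by auto
  then have "measure lebesgue (B \<inter> \<Union>\<V> - \<Union>\<F>) = measure lebesgue (B \<inter> \<Union>\<V>) - measure lebesgue (B \<inter> \<Union>\<F>)"
    unfolding diff using m by (simp add: measurable_measure_Diff fmeasurableD)
  then have "measure lebesgue (B \<inter> \<Union>\<V> - \<Union>\<F>) < e"
    using \<D>(3) unfolding eqV eqF by linarith
  moreover have "B \<inter> \<Union>\<V> - \<Union>\<F> \<in> lmeasurable"
    unfolding diff using m by (simp add: fmeasurable.Diff)
  ultimately show ?thesis
    using that \<F>(1,2) \<V>'(1) by (meson order_trans)
qed

text \<open>
  Measurability of \<open>S\<close> is never at issue: the relatively open sets are extended to open sets of the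
  whole space, and all estimates are made for those.
\<close>
lemma Menger_space_of_countable_negligible_traces:
  fixes S :: "'a::euclidean_space set"
  assumes S: "\<And>N. negligible N \<Longrightarrow> countable (S \<inter> N)"
  shows "Menger_space (top_of_set S)"
  unfolding Menger_space_def
proof (intro allI impI)
  fix \<U> :: "nat \<Rightarrow> 'a set set"
  assume "\<forall>n. \<U> n \<in> open_covers (top_of_set S)"
  then have opn: "\<And>n U. U \<in> \<U> n \<Longrightarrow> openin (top_of_set S) U" and cov: "\<And>n. \<Union>(\<U> n) = S"
    by (auto simp: open_covers_def)
  define \<V> where "\<V> n = {V. open V \<and> S \<inter> V \<in> \<U> n}" for n
  have sub: "S \<subseteq> \<Union>(\<V> n)" for n
  proof
    fix x assume "x \<in> S"
    then obtain U where "x \<in> U" "U \<in> \<U> n"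
      using cov by blast
    moreover then obtain V where "open V" "U = S \<inter> V"
      using opn openin_open by metis
    ultimately show "x \<in> \<Union>(\<V> n)"
      by (auto simp: \<V>_def)
  qed
  have "\<exists>\<F>. finite \<F> \<and> \<F> \<subseteq> \<V> n \<and> cball 0 (real n) \<inter> \<Union>(\<V> n) - \<Union>\<F> \<in> lmeasurable \<and>
      measure lebesgue (cball 0 (real n) \<inter> \<Union>(\<V> n) - \<Union>\<F>) < (1/2)^n" for n
    by (rule finite_subfamily_small_remainder[of "cball 0 (real n)" "\<V> n" "(1/2)^n"])
       (auto simp: \<V>_def)
  then obtain \<F> where \<F>: "\<And>n. finite (\<F> n)" "\<And>n. \<F> n \<subseteq> \<V> n"
    and bad: "\<And>n. cball 0 (real n) \<inter> \<Union>(\<V> n) - \<Union>(\<F> n) \<in> lmeasurable"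
      "\<And>n. measure lebesgue (cball 0 (real n) \<inter> \<Union>(\<V> n) - \<Union>(\<F> n)) < (1/2)^n"
    by metis
  define R where "R n = cball 0 (real n) \<inter> \<Union>(\<V> n) - \<Union>(\<F> n)" for n
  have "limsup R \<in> null_sets lebesgue"
  proof (rule borel_cantelli_limsup1)
    show "R n \<in> sets lebesgue" for n
      using bad(1) by (auto simp: R_def)
    show "emeasure lebesgue (R n) < \<infinity>" for n
      using fmeasurableD2[OF bad(1)[of n]] by (simp add: R_def less_top)
    show "summable (\<lambda>n. measure lebesgue (R n))"
      using bad(2) by (intro summable_comparison_test'[OF summable_geometric[of "1/2::real"]])
        (auto simp: R_def intro: less_imp_le)
  qed
  then have ctb: "countable (S \<inter> limsup R)"
    by (simp add: S negligible_iff_null_sets)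
  define c where "c = from_nat_into (S \<inter> limsup R)"
  \<comment> \<open>The conditional matters when there are no leftover points: then \<open>c n\<close> is arbitrary and may lie
    outside \<open>S\<close>.\<close>
  have "\<exists>\<E>. finite \<E> \<and> \<E> \<subseteq> \<U> n \<and> (c n \<in> S \<longrightarrow> c n \<in> \<Union>\<E>)" for n
  proof (cases "c n \<in> S")
    case True
    then obtain U where "U \<in> \<U> n" "c n \<in> U"
      using cov by blast
    then show ?thesis
      by (intro exI[of _ "{U}"]) auto
  qed (intro exI[of _ "{}"], auto)
  then obtain \<E> where \<E>: "\<And>n. finite (\<E> n)" "\<And>n. \<E> n \<subseteq> \<U> n"
      "\<And>n. c n \<in> S \<Longrightarrow> c n \<in> \<Union>(\<E> n)"
    by metis
  define \<H> where "\<H> n = (\<inter>) S ` \<F> n \<union> \<E> n" for n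
  have fin: "finite (\<H> n)" and sel: "\<H> n \<subseteq> \<U> n" for n
    using \<F> \<E> by (auto simp: \<H>_def \<V>_def)
  have "S \<subseteq> \<Union>(\<Union>n. \<H> n)"
  proof
    fix x assume x: "x \<in> S"
    show "x \<in> \<Union>(\<Union>n. \<H> n)"
    proof (cases "x \<in> limsup R")
      case True
      then obtain n where "c n = x"
        using ctb x unfolding c_def by (metis IntI from_nat_into_surj)
      then show ?thesis
        using \<E>(3)[of n] x by (auto simp: \<H>_def)
    next
      case False
      then obtain m where m: "\<And>n. n \<ge> m \<Longrightarrow> x \<notin> R n"
        by (auto simp: limsup_INF_SUP)
      obtain k where k: "norm x \<le> real k"
        using real_arch_simple by blast
      have "x \<in> cball 0 (real (max m k))"
        using k by simp
      moreover have "x \<in> \<Union>(\<V> (max m k))"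
        using sub x by blast
      ultimately have "x \<in> \<Union>(\<F> (max m k))"
        using m[of "max m k"] by (auto simp: R_def)
      then have "x \<in> \<Union>(\<H> (max m k))"
        using x by (auto simp: \<H>_def)
      then show ?thesis
        by blast
    qed
  qed
  moreover have "\<Union>(\<Union>n. \<H> n) \<subseteq> S"
    using sel cov by blast
  ultimately show "\<exists>\<F>. (\<forall>n. finite (\<F> n) \<and> \<F> n \<subseteq> \<U> n) \<and> \<Union>(\<Union>n. \<F> n) = topspace (top_of_set S)"
    using fin sel by (intro exI[of _ \<H>]) auto
qed

section \<open>Failure of the selection principle\<close>

lemma not_S1_of_negligible_compact_subsets:
  fixes S :: "'a::euclidean_space set"
  assumes "\<not> negligible S" and K: "\<And>K. compact K \<Longrightarrow> K \<subseteq> S \<Longrightarrow> negligible K"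
  shows "\<not> S1 (k_covers (top_of_set S)) (open_covers (top_of_set S))"
proof
  assume S1: "S1 (k_covers (top_of_set S)) (open_covers (top_of_set S))"
  obtain e where "e > 0"
    and e: "\<And>T. S \<subseteq> T \<Longrightarrow> T \<in> lmeasurable \<Longrightarrow> \<not> measure lebesgue T \<le> e"
    using assms(1) unfolding negligible_outer_le by blast
  define small where
    "small n V \<longleftrightarrow> open V \<and> V \<in> lmeasurable \<and> measure lebesgue V < e * (1/2)^Suc n"
    for n and V :: "'a set"
  define \<U> where "\<U> n = (\<inter>) S ` Collect (small n)" for n
  have k: "\<exists>U\<in>\<U> n. C \<subseteq> U" if C: "compact C" "C \<subseteq> S" for C n
  proof -
    have "negligible C"
      using K C by blast
    moreover have "0 < e * (1/2)^Suc n"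
      using \<open>e > 0\<close> by simp
    ultimately obtain V where "C \<subseteq> V" "small n V"
      unfolding small_def by (meson negligible_outer_openE)
    then show ?thesis
      using C by (auto simp: \<U>_def)
  qed
  have "\<U> n \<in> k_covers (top_of_set S)" for n
  proof -
    have "S \<subseteq> \<Union>(\<U> n)"
    proof
      fix x assume "x \<in> S"
      then show "x \<in> \<Union>(\<U> n)"
        using k[of "{x}" n] by auto
    qed
    moreover have "\<Union>(\<U> n) \<subseteq> S"
      by (auto simp: \<U>_def)
    ultimately have "\<U> n \<in> open_covers (top_of_set S)"
      by (auto simp: open_covers_def \<U>_def small_def openin_open_Int)
    then show ?thesis
      using k by (auto simp: k_covers_def compactin_subtopology)
  qed
  then obtain B where B: "\<And>n. B n \<in> \<U> n" "range B \<in> open_covers (top_of_set S)"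
    using S1 unfolding S1_def by metis
  have "\<forall>n. \<exists>V. B n = S \<inter> V \<and> small n V"
    using B(1) by (auto simp: \<U>_def)
  then obtain V where V: "\<And>n. B n = S \<inter> V n" "\<And>n. small n (V n)"
    by metis
  have "S \<subseteq> (\<Union>n. V n)"
    using B(2) V(1) by (auto simp: open_covers_def)
  moreover have bound: "measure lebesgue (\<Union>i\<le>n. V i) \<le> e" for n
  proof -
    have "measure lebesgue (\<Union>i\<le>n. V i) \<le> (\<Sum>i\<le>n. measure lebesgue (V i))"
      using V(2) by (intro measure_UNION_le) (auto simp: small_def)
    also have "\<dots> \<le> (\<Sum>i\<le>n. e * (1/2)^Suc i)"
      using V(2) unfolding small_def by (intro sum_mono less_imp_le) blast
    also have "\<dots> = e * (\<Sum>i\<le>n. (1/2)^Suc i)"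
      by (simp add: sum_distrib_left)
    also have "(\<Sum>i\<le>n. (1/2::real)^Suc i) \<le> 1"
      using sum_le_suminf[of "\<lambda>i. (1/2::real)^Suc i" "{..n}"] power_half_series
      by (auto simp: sums_iff)
    finally show ?thesis
      using \<open>e > 0\<close> by simp
  qed
  moreover have "\<And>n. V n \<in> lmeasurable"
    using V(2) by (auto simp: small_def)
  ultimately show False
    using e fmeasurable_countable_Union[of V lebesgue e] measure_countable_Union_le[of V lebesgue e]
    by blast
qed

section \<open>The Sierpinski subspace\<close>

theorem mainTheorem4:
  assumes "\<exists>S. Sierpinski_set S"
  shows "\<exists>X :: real topology.
           regular_space X \<and> t1_space X \<and> Menger_space X \<and>
           \<not> S1 (k_covers X) (open_covers X)"
proof -
  obtain S where "uncountable S" and S: "\<And>N :: real set. negligible N \<Longrightarrow> countable (S \<inter> N)"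
    using assms by (auto simp: Sierpinski_set_def negligible_iff_null_sets)
  have "\<not> negligible S"
    using S[of S] \<open>uncountable S\<close> by auto
  moreover have "negligible K" if K: "compact K" "K \<subseteq> S" for K
  proof (rule ccontr)
    assume "\<not> negligible K"
    then have "uncountable K"
      using countable_imp_negligible by blast
    then obtain N where "N \<subseteq> K" "negligible N" "uncountable N"
      using uncountable_closed_contains_uncountable_negligible compact_imp_closed K(1) by metis
    moreover then have "S \<inter> N = N"
      using K(2) by auto
    ultimately show False
      using S by metis
  qed
  ultimately have "\<not> S1 (k_covers (top_of_set S)) (open_covers (top_of_set S))"
    by (rule not_S1_of_negligible_compact_subsets)
  moreover have "Menger_space (top_of_set S)"
    using S by (rule Menger_space_of_countable_negligible_traces)
  moreover have "regular_space (top_of_set S)" "t1_space (top_of_set S)"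
    by (simp_all add: regular_space_subtopology regular_space_euclidean
        t1_space_subtopology t1_space_euclidean)
  ultimately show ?thesis
    by blast
qed

end
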